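(* Let $n\ge1$. The graded $S_n$-representation $H^*((\mathbb{C}\mathbb{P}^\infty)^n,\mathbb{R})=\mathbb{R}[t_1,\dots,t_n]$ is strongly equivariantly log-concave: writing $V^i$ for its degree-$2i$ piece (where each $t_k$ has degree $2$), for any $m\ge0$ there are inclusions of $S_n$-representations $$V^0\otimes V^m\subset V^1\otimes V^{m-1}\subset V^2\otimes V^{m-2}\subset\cdots\subset\begin{cases}V^{m/2}\otimes V^{m/2}&\text{if } m \text{ is even},\\ V^{(m-1)/2}\otimes V^{(m+1)/2}&\text{if } m\text{ is odd}.\end{cases}$$ Furthermore, the inclusions $V^{i-1}\otimes V^{m-i+1}\to V^{i}\otimes V^{m-i}$ ($1\le i\le \lfloor m/2\rfloor$) of $S_n$-representations are given by the operator $L=\sum_{k=1}^n t_k\otimes\frac{\partial}{\partial t_k}$, where $t_k$ acts by multiplication.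
   Context: $S_n$ acts on $(\mathbb{C}\mathbb{P}^\infty)^n$ by permuting the factors; the induced action on the cohomology ring $\mathbb{R}[t_1,\dots,t_n]$ is by permuting the indices of the variables. Thus $V^i$ is the space of homogeneous polynomials of polynomial degree $i$ in $t_1,\dots,t_n$. The symbol $\subset$ between representations means that there is an injective $S_n$-equivariant linear map. *)

theory Defs
  imports "HOL-Analysis.Analysis" "HOL-Analysis.Finite_Function_Topology" "HOL-Algebra.Sym_Groups"
begin

section \<open>Linear extension from a basis\<close>

text \<open>Elements of \<^typ>\<open>'k \<Rightarrow>\<^sub>0 real\<close> are the finite formal real combinations of elements of
  \<^typ>\<open>'k\<close>; their vector space structure is the one of
  \<^theory>\<open>HOL-Analysis.Finite_Function_Topology\<close>.\<close>

definition lin_ext :: "('k \<Rightarrow> 'v::real_vector) \<Rightarrow> ('k \<Rightarrow>\<^sub>0 real) \<Rightarrow> 'v" where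
  "lin_ext \<phi> p = (\<Sum>k\<in>Poly_Mapping.keys p. Poly_Mapping.lookup p k *\<^sub>R \<phi> k)"

lemma lookup_scaleR_pm: "Poly_Mapping.lookup (c *\<^sub>R p) k = c *\<^sub>R Poly_Mapping.lookup p k"
  for p :: "'k \<Rightarrow>\<^sub>0 'v::real_vector"
proof -
  have "{i. c *\<^sub>R Poly_Mapping.lookup p i \<noteq> 0} \<subseteq> Poly_Mapping.keys p"
    by (auto simp: in_keys_iff)
  then have "finite {i. c *\<^sub>R Poly_Mapping.lookup p i \<noteq> 0}"
    by (rule finite_subset) simp
  then show ?thesis
    by (simp add: scaleR_poly_mapping_def)
qed

lemma lin_ext_superset:
  assumes "finite A" "Poly_Mapping.keys p \<subseteq> A"
  shows "lin_ext \<phi> p = (\<Sum>k\<in>A. Poly_Mapping.lookup p k *\<^sub>R \<phi> k)"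
  unfolding lin_ext_def using assms
  by (intro sum.mono_neutral_left) (auto simp: in_keys_iff)

lemma linear_lin_ext: "linear (lin_ext \<phi>)"
proof (rule linearI)
  fix p q :: "'a \<Rightarrow>\<^sub>0 real"
  let ?A = "Poly_Mapping.keys p \<union> Poly_Mapping.keys q"
  have "lin_ext \<phi> (p + q) = (\<Sum>k\<in>?A. Poly_Mapping.lookup (p + q) k *\<^sub>R \<phi> k)"
    by (rule lin_ext_superset) (simp_all add: Poly_Mapping.keys_add)
  also have "\<dots> = lin_ext \<phi> p + lin_ext \<phi> q"
    using lin_ext_superset[of ?A p \<phi>] lin_ext_superset[of ?A q \<phi>]
    by (simp only: lookup_add scaleR_left_distrib sum.distrib) simp
  finally show "lin_ext \<phi> (p + q) = lin_ext \<phi> p + lin_ext \<phi> q" .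
next
  fix c and p :: "'a \<Rightarrow>\<^sub>0 real"
  have "lin_ext \<phi> (c *\<^sub>R p) = (\<Sum>k\<in>Poly_Mapping.keys p. Poly_Mapping.lookup (c *\<^sub>R p) k *\<^sub>R \<phi> k)"
    by (rule lin_ext_superset) (auto simp: in_keys_iff lookup_scaleR_pm)
  also have "\<dots> = c *\<^sub>R lin_ext \<phi> p"
    by (simp add: lin_ext_def lookup_scaleR_pm scaleR_sum_right)
  finally show "lin_ext \<phi> (c *\<^sub>R p) = c *\<^sub>R lin_ext \<phi> p" .
qed

lemma lin_ext_single [simp]: "lin_ext \<phi> (Poly_Mapping.single k c) = c *\<^sub>R \<phi> k"
  by (simp add: lin_ext_def)

lemma lin_ext_expansion: "p = lin_ext (\<lambda>k. Poly_Mapping.single k 1) p"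
  for p :: "'k \<Rightarrow>\<^sub>0 real"
proof (rule poly_mapping_eqI)
  fix j
  show "Poly_Mapping.lookup p j
      = Poly_Mapping.lookup (lin_ext (\<lambda>k. Poly_Mapping.single k 1) p) j"
    by (simp add: lin_ext_def lookup_sum lookup_scaleR_pm lookup_single when_def in_keys_iff
        if_distrib[of "(*) _"] cong: if_cong)
qed

lemma lin_ext_unique:
  assumes "linear f" "\<And>k. f (Poly_Mapping.single k 1) = \<phi> k"
  shows "f p = lin_ext \<phi> p"
proof -
  have "f p = f (lin_ext (\<lambda>k. Poly_Mapping.single k 1) p)"
    by (rule arg_cong[OF lin_ext_expansion])
  also have "\<dots> = lin_ext \<phi> p"
    unfolding lin_ext_def linear_sum[OF assms(1)] linear_scale[OF assms(1)] assms(2) ..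
  finally show ?thesis .
qed


section \<open>Tensor products of real vector spaces\<close>

text \<open>The tensor product is the free vector space on pairs modulo the bilinearity relations.\<close>

definition tensor_relators :: "(('a::real_vector \<times> 'b::real_vector) \<Rightarrow>\<^sub>0 real) set" where
  "tensor_relators =
     (let \<delta> = (\<lambda>a b. Poly_Mapping.single (a, b) 1) in
       {\<delta> (a + a') b - \<delta> a b - \<delta> a' b | a a' b. True}
     \<union> {\<delta> a (b + b') - \<delta> a b - \<delta> a b' | a b b'. True}
     \<union> {\<delta> (c *\<^sub>R a) b - c *\<^sub>R \<delta> a b | c a b. True}
     \<union> {\<delta> a (c *\<^sub>R b) - c *\<^sub>R \<delta> a b | c a b. True})"

definition tensor_rel ::
    "(('a::real_vector \<times> 'b::real_vector) \<Rightarrow>\<^sub>0 real) \<Rightarrow> (('a \<times> 'b) \<Rightarrow>\<^sub>0 real) \<Rightarrow> bool" where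
  "tensor_rel x y \<longleftrightarrow> x - y \<in> span tensor_relators"

lemma equivp_tensor_rel: "equivp tensor_rel"
proof (rule equivpI)
  show "reflp tensor_rel"
    by (auto simp: reflp_def tensor_rel_def span_zero)
  show "symp tensor_rel"
    unfolding symp_def tensor_rel_def using span_neg by fastforce
  show "transp tensor_rel"
    unfolding transp_def tensor_rel_def using span_add by fastforce
qed

quotient_type (overloaded) ('a, 'b) tensor =
  "('a::real_vector \<times> 'b::real_vector) \<Rightarrow>\<^sub>0 real" / tensor_rel
  by (rule equivp_tensor_rel)

instantiation tensor :: (real_vector, real_vector) real_vector
begin

lift_definition zero_tensor :: "('a, 'b) tensor" is 0 .

lift_definition plus_tensor :: "('a, 'b) tensor \<Rightarrow> ('a, 'b) tensor \<Rightarrow> ('a, 'b) tensor" is "(+)"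
  unfolding tensor_rel_def add_diff_add by (rule span_add)

lift_definition uminus_tensor :: "('a, 'b) tensor \<Rightarrow> ('a, 'b) tensor" is uminus
  unfolding tensor_rel_def minus_diff_minus by (rule span_neg)

lift_definition minus_tensor :: "('a, 'b) tensor \<Rightarrow> ('a, 'b) tensor \<Rightarrow> ('a, 'b) tensor" is "(-)"
proof -
  fix x x' :: "('a \<times> 'b) \<Rightarrow>\<^sub>0 real" and y y' :: "('a \<times> 'b) \<Rightarrow>\<^sub>0 real"
  assume "tensor_rel x x'" "tensor_rel y y'"
  then have "(x - x') - (y - y') \<in> span tensor_relators"
    unfolding tensor_rel_def by (rule span_diff)
  then show "tensor_rel (x - y) (x' - y')"
    unfolding tensor_rel_def by (simp add: algebra_simps)
qed

lift_definition scaleR_tensor :: "real \<Rightarrow> ('a, 'b) tensor \<Rightarrow> ('a, 'b) tensor" is "(*\<^sub>R)"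
  unfolding tensor_rel_def scaleR_diff_right[symmetric] by (rule span_scale)

instance
proof
  fix x y z :: "('a, 'b) tensor" and c d :: real
  note refl = equivp_reflp[OF equivp_tensor_rel]
  show "x + y + z = x + (y + z)" by transfer (simp add: refl add.assoc)
  show "x + y = y + x" by transfer (simp add: refl add.commute)
  show "0 + x = x" by transfer (simp add: refl)
  show "- x + x = 0" by transfer (simp add: refl)
  show "x - y = x + - y" by transfer (simp add: refl)
  show "c *\<^sub>R (x + y) = c *\<^sub>R x + c *\<^sub>R y" by transfer (simp add: refl scaleR_right_distrib)
  show "(c + d) *\<^sub>R x = c *\<^sub>R x + d *\<^sub>R x" by transfer (simp add: refl scaleR_left_distrib)
  show "c *\<^sub>R d *\<^sub>R x = (c * d) *\<^sub>R x" by transfer (simp add: refl)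
  show "1 *\<^sub>R x = x" by transfer (simp add: refl)
qed

end

lift_definition pure_tensor ::
    "'a::real_vector \<Rightarrow> 'b::real_vector \<Rightarrow> ('a, 'b) tensor" (infixr \<open>\<otimes>\<^sub>t\<close> 70)
  is "\<lambda>a b. Poly_Mapping.single (a, b) 1" .

text \<open>The linear map on the tensor product induced by a bilinear map; the definite description is
  justified for bilinear arguments by \<open>tensor_lift_pure\<close> and \<open>tensor_linear_eqI\<close> below.\<close>

definition tensor_lift ::
    "('a::real_vector \<Rightarrow> 'b::real_vector \<Rightarrow> 'c::real_vector) \<Rightarrow> ('a, 'b) tensor \<Rightarrow> 'c" where
  "tensor_lift B = (THE h. linear h \<and> (\<forall>a b. h (a \<otimes>\<^sub>t b) = B a b))"

definition tensor_map ::
    "('a::real_vector \<Rightarrow> 'c::real_vector) \<Rightarrow> ('b::real_vector \<Rightarrow> 'd::real_vector)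
      \<Rightarrow> ('a, 'b) tensor \<Rightarrow> ('c, 'd) tensor" where
  "tensor_map f g = tensor_lift (\<lambda>a b. f a \<otimes>\<^sub>t g b)"

text \<open>For subspaces \<open>V\<close> and \<open>W\<close> of the ambient spaces, \<open>V \<otimes> W\<close> is realised inside the tensor product
  of the ambient spaces. Over a field nothing is lost, see \<open>tensor_space_universal\<close> below.\<close>

definition tensor_space ::
    "'a::real_vector set \<Rightarrow> 'b::real_vector set \<Rightarrow> ('a, 'b) tensor set" where
  "tensor_space V W = span {v \<otimes>\<^sub>t w | v w. v \<in> V \<and> w \<in> W}"

lemma tensor_relator_mem:
  fixes a a' :: "'a::real_vector" and b b' :: "'b::real_vector"
  shows "Poly_Mapping.single (a + a', b) 1 - Poly_Mapping.single (a, b) 1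
           - Poly_Mapping.single (a', b) 1 \<in> tensor_relators"
    and "Poly_Mapping.single (a, b + b') 1 - Poly_Mapping.single (a, b) 1
           - Poly_Mapping.single (a, b') 1 \<in> tensor_relators"
    and "Poly_Mapping.single (c *\<^sub>R a, b) 1 - c *\<^sub>R Poly_Mapping.single (a, b) 1 \<in> tensor_relators"
    and "Poly_Mapping.single (a, c *\<^sub>R b) 1 - c *\<^sub>R Poly_Mapping.single (a, b) 1 \<in> tensor_relators"
  unfolding tensor_relators_def Let_def by blast+

lemma bilinear_pure_tensor: "bilinear (\<otimes>\<^sub>t)"
  unfolding bilinear_def
proof (intro conjI allI linearI)
  fix a a' :: 'a and b b' :: 'b and c :: real
  show "a \<otimes>\<^sub>t (b + b') = a \<otimes>\<^sub>t b + a \<otimes>\<^sub>t b'"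
    by transfer (simp add: tensor_rel_def diff_diff_eq[symmetric] span_base tensor_relator_mem)
  show "(a + a') \<otimes>\<^sub>t b = a \<otimes>\<^sub>t b + a' \<otimes>\<^sub>t b"
    by transfer (simp add: tensor_rel_def diff_diff_eq[symmetric] span_base tensor_relator_mem)
  show "a \<otimes>\<^sub>t (c *\<^sub>R b) = c *\<^sub>R (a \<otimes>\<^sub>t b)"
    by transfer (simp add: tensor_rel_def span_base tensor_relator_mem)
  show "(c *\<^sub>R a) \<otimes>\<^sub>t b = c *\<^sub>R (a \<otimes>\<^sub>t b)"
    by transfer (simp add: tensor_rel_def span_base tensor_relator_mem)
qed

lemma linear_abs_tensor: "linear abs_tensor"
  by (rule linearI) (simp_all add: plus_tensor.abs_eq scaleR_tensor.abs_eq)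

lemma tensor_linear_eqI:
  assumes "linear h" "linear h'" "\<And>a b. h (a \<otimes>\<^sub>t b) = h' (a \<otimes>\<^sub>t b)"
  shows "h = h'"
proof
  fix x
  have "(h \<circ> abs_tensor) p = (h' \<circ> abs_tensor) p" for p
  proof -
    have lin: "linear (h \<circ> abs_tensor)" "linear (h' \<circ> abs_tensor)"
      by (simp_all add: assms linear_abs_tensor linear_compose)
    have "(h \<circ> abs_tensor) p = lin_ext (\<lambda>(a, b). h (a \<otimes>\<^sub>t b)) p"
      by (rule lin_ext_unique[OF lin(1)]) (auto simp: pure_tensor.abs_eq)
    moreover have "(h' \<circ> abs_tensor) p = lin_ext (\<lambda>(a, b). h (a \<otimes>\<^sub>t b)) p"
      by (rule lin_ext_unique[OF lin(2)]) (auto simp: pure_tensor.abs_eq assms(3)[unfolded pure_tensor.abs_eq])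
    ultimately show ?thesis by simp
  qed
  then show "h x = h' x"
    by (metis comp_apply Quotient3_abs_rep[OF Quotient3_tensor])
qed

lemma tensor_lift_exists:
  assumes "bilinear B"
  shows "\<exists>h. linear h \<and> (\<forall>a b. h (a \<otimes>\<^sub>t b) = B a b)"
proof -
  define \<phi> where "\<phi> = (\<lambda>(a, b). B a b)"
  have sub: "subspace {p. lin_ext \<phi> p = 0}"
    by (rule linear_subspace_kernel[OF linear_lin_ext])
  have "tensor_relators \<subseteq> {p. lin_ext \<phi> p = 0}"
    by (auto simp: tensor_relators_def Let_def linear_diff[OF linear_lin_ext]
        linear_scale[OF linear_lin_ext] \<phi>_def bilinear_ladd[OF assms] bilinear_radd[OF assms]
        bilinear_lmul[OF assms] bilinear_rmul[OF assms])
  then have ker: "span tensor_relators \<subseteq> {p. lin_ext \<phi> p = 0}"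
    using span_minimal sub by blast
  define h where "h = (\<lambda>x. lin_ext \<phi> (rep_tensor x))"
  have habs: "h (abs_tensor p) = lin_ext \<phi> p" for p
  proof -
    have "tensor_rel (rep_tensor (abs_tensor p)) p"
      by (rule Quotient3_rep_abs[OF Quotient3_tensor])
        (simp add: tensor_rel_def span_zero)
    then have "lin_ext \<phi> (rep_tensor (abs_tensor p) - p) = 0"
      using ker unfolding tensor_rel_def by blast
    then show ?thesis
      by (simp add: h_def linear_diff[OF linear_lin_ext])
  qed
  have ex: "\<exists>p. x = abs_tensor p" for x :: "('a, 'b) tensor"
    by (metis Quotient3_abs_rep[OF Quotient3_tensor])
  have "linear h"
  proof (rule linearI)
    fix x y :: "('a, 'b) tensor" and c :: real
    obtain p q where pq: "x = abs_tensor p" "y = abs_tensor q"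
      using ex[of x] ex[of y] by blast
    show "h (x + y) = h x + h y"
      unfolding pq plus_tensor.abs_eq habs by (rule linear_add[OF linear_lin_ext])
    show "h (c *\<^sub>R x) = c *\<^sub>R h x"
      unfolding pq scaleR_tensor.abs_eq habs by (rule linear_scale[OF linear_lin_ext])
  qed
  moreover have "h (a \<otimes>\<^sub>t b) = B a b" for a b
    unfolding pure_tensor.abs_eq habs by (simp add: \<phi>_def)
  ultimately show ?thesis by blast
qed

lemma tensor_lift_pure:
  assumes "bilinear B"
  shows "linear (tensor_lift B)" and "tensor_lift B (a \<otimes>\<^sub>t b) = B a b"
proof -
  have "\<exists>!h. linear h \<and> (\<forall>a b. h (a \<otimes>\<^sub>t b) = B a b)"
  proof (rule ex_ex1I[OF tensor_lift_exists[OF assms]])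
    fix h h' :: "('a, 'b) tensor \<Rightarrow> 'c"
    assume "linear h \<and> (\<forall>a b. h (a \<otimes>\<^sub>t b) = B a b)" "linear h' \<and> (\<forall>a b. h' (a \<otimes>\<^sub>t b) = B a b)"
    then show "h = h'"
      by (intro tensor_linear_eqI) simp_all
  qed
  then have "linear (tensor_lift B) \<and> (\<forall>a b. tensor_lift B (a \<otimes>\<^sub>t b) = B a b)"
    unfolding tensor_lift_def by (rule theI')
  then show "linear (tensor_lift B)" and "tensor_lift B (a \<otimes>\<^sub>t b) = B a b"
    by simp_all
qed

lemma tensor_map_pure:
  assumes "linear f" "linear g"
  shows "linear (tensor_map f g)" and "tensor_map f g (a \<otimes>\<^sub>t b) = f a \<otimes>\<^sub>t g b"
proof -
  have "bilinear (\<lambda>a b. f a \<otimes>\<^sub>t g b)"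
    unfolding bilinear_def
    by (intro conjI allI linearI)
      (simp_all add: linear_add[OF assms(1)] linear_add[OF assms(2)] linear_scale[OF assms(1)]
        linear_scale[OF assms(2)] bilinear_ladd[OF bilinear_pure_tensor]
        bilinear_radd[OF bilinear_pure_tensor] bilinear_lmul[OF bilinear_pure_tensor]
        bilinear_rmul[OF bilinear_pure_tensor])
  then show "linear (tensor_map f g)" and "tensor_map f g (a \<otimes>\<^sub>t b) = f a \<otimes>\<^sub>t g b"
    unfolding tensor_map_def by (rule tensor_lift_pure)+
qed

lemma subspace_projection:
  fixes V :: "'a::real_vector set"
  assumes "subspace V"
  shows "\<exists>P. linear P \<and> range P \<subseteq> V \<and> (\<forall>v\<in>V. P v = v)"
  using linear_exists_left_inverse_on[of "id :: 'a \<Rightarrow> 'a" V] assms linear_id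
  by (auto simp: inj_on_def)

text \<open>The universal property of \<open>V \<otimes> W\<close>, for maps that are bilinear merely on the subspaces. The
  extension is determined on \<^term>\<open>tensor_space V W\<close> by its values on pure tensors.\<close>

lemma tensor_space_universal:
  fixes B :: "'a::real_vector \<Rightarrow> 'b::real_vector \<Rightarrow> 'c::real_vector"
  assumes V: "subspace V" and W: "subspace W"
    and "\<And>v v' w. v \<in> V \<Longrightarrow> v' \<in> V \<Longrightarrow> w \<in> W \<Longrightarrow> B (v + v') w = B v w + B v' w"
    and "\<And>v w w'. v \<in> V \<Longrightarrow> w \<in> W \<Longrightarrow> w' \<in> W \<Longrightarrow> B v (w + w') = B v w + B v w'"
    and "\<And>c v w. v \<in> V \<Longrightarrow> w \<in> W \<Longrightarrow> B (c *\<^sub>R v) w = c *\<^sub>R B v w"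
    and "\<And>c v w. v \<in> V \<Longrightarrow> w \<in> W \<Longrightarrow> B v (c *\<^sub>R w) = c *\<^sub>R B v w"
  shows "\<exists>h. linear h \<and> (\<forall>v\<in>V. \<forall>w\<in>W. h (v \<otimes>\<^sub>t w) = B v w)"
proof -
  obtain P where P: "linear P" "\<And>x. P x \<in> V" "\<And>v. v \<in> V \<Longrightarrow> P v = v"
    using subspace_projection[OF V] by blast
  obtain Q where Q: "linear Q" "\<And>x. Q x \<in> W" "\<And>w. w \<in> W \<Longrightarrow> Q w = w"
    using subspace_projection[OF W] by blast
  have "bilinear (\<lambda>a b. B (P a) (Q b))"
    unfolding bilinear_def
    by (intro conjI allI linearI)
      (simp_all add: assms P(2) Q(2) linear_add[OF P(1)] linear_add[OF Q(1)]
        linear_scale[OF P(1)] linear_scale[OF Q(1)])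
  from tensor_lift_exists[OF this] show ?thesis
    using P(3) Q(3) by metis
qed


section \<open>Representations\<close>

text \<open>A representation on a subspace \<open>V\<close>. Every linear map on \<open>V\<close> extends to the ambient space, so
  requiring \<^term>\<open>\<rho> g\<close> to be linear on the whole type (here) or \<open>f\<close> (in \<open>rep_inclusion\<close>) is no
  restriction; all other conditions concern \<open>V\<close> only.\<close>

definition representation ::
    "('g, 'm) monoid_scheme \<Rightarrow> ('g \<Rightarrow> 'v::real_vector \<Rightarrow> 'v) \<Rightarrow> 'v set \<Rightarrow> bool" where
  "representation G \<rho> V \<longleftrightarrow>
     group G \<and> subspace V
     \<and> (\<forall>g\<in>carrier G. linear (\<rho> g) \<and> \<rho> g ` V \<subseteq> V)
     \<and> (\<forall>v\<in>V. \<rho> \<one>\<^bsub>G\<^esub> v = v)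
     \<and> (\<forall>g\<in>carrier G. \<forall>h\<in>carrier G. \<forall>v\<in>V. \<rho> (g \<otimes>\<^bsub>G\<^esub> h) v = \<rho> g (\<rho> h v))"

definition rep_inclusion ::
    "('g, 'm) monoid_scheme \<Rightarrow> ('g \<Rightarrow> 'v::real_vector \<Rightarrow> 'v) \<Rightarrow> 'v set
      \<Rightarrow> ('g \<Rightarrow> 'w::real_vector \<Rightarrow> 'w) \<Rightarrow> 'w set \<Rightarrow> ('v \<Rightarrow> 'w) \<Rightarrow> bool" where
  "rep_inclusion G \<rho> V \<rho>' W f \<longleftrightarrow>
     representation G \<rho> V \<and> representation G \<rho>' W
     \<and> linear f \<and> f ` V \<subseteq> W \<and> inj_on f V
     \<and> (\<forall>g\<in>carrier G. \<forall>v\<in>V. f (\<rho> g v) = \<rho>' g (f v))"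

definition tensor_action ::
    "('g \<Rightarrow> 'v::real_vector \<Rightarrow> 'v) \<Rightarrow> ('g \<Rightarrow> 'w::real_vector \<Rightarrow> 'w)
      \<Rightarrow> 'g \<Rightarrow> ('v, 'w) tensor \<Rightarrow> ('v, 'w) tensor" where
  "tensor_action \<rho> \<rho>' g = tensor_map (\<rho> g) (\<rho>' g)"

definition strongly_equiv_log_concave ::
    "('g, 'm) monoid_scheme \<Rightarrow> ('g \<Rightarrow> 'v::real_vector \<Rightarrow> 'v) \<Rightarrow> (nat \<Rightarrow> 'v set) \<Rightarrow> bool" where
  "strongly_equiv_log_concave G \<rho> V \<longleftrightarrow>
     (\<forall>i. representation G \<rho> (V i))
     \<and> (\<forall>m. \<forall>i\<in>{1..m div 2}. \<exists>f.
          rep_inclusion G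
            (tensor_action \<rho> \<rho>) (tensor_space (V (i - 1)) (V (m - i + 1)))
            (tensor_action \<rho> \<rho>) (tensor_space (V i) (V (m - i))) f)"


section \<open>The polynomial ring\<close>

text \<open>Polynomials in \<open>t\<^sub>0, t\<^sub>1, t\<^sub>2, \<dots>\<close>, as finitely supported maps from exponent vectors to
  coefficients.\<close>

type_synonym rpoly = "(nat \<Rightarrow>\<^sub>0 nat) \<Rightarrow>\<^sub>0 real"

definition var :: "nat \<Rightarrow> rpoly" where
  "var k = Poly_Mapping.single (Poly_Mapping.single k 1) 1"

definition poly_ring :: "nat \<Rightarrow> rpoly set" where
  "poly_ring n = {p. \<forall>e\<in>Poly_Mapping.keys p. Poly_Mapping.keys e \<subseteq> {1..n}}"

text \<open>The grading in which every variable has degree 2; \<open>graded_piece n i\<close> is the piece of degree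
  \<open>2 * i\<close>.\<close>

definition monomial_degree :: "(nat \<Rightarrow>\<^sub>0 nat) \<Rightarrow> nat" where
  "monomial_degree e = (\<Sum>k\<in>Poly_Mapping.keys e. 2 * Poly_Mapping.lookup e k)"

definition graded_piece :: "nat \<Rightarrow> nat \<Rightarrow> rpoly set" where
  "graded_piece n i = {p \<in> poly_ring n. \<forall>e\<in>Poly_Mapping.keys p. monomial_degree e = 2 * i}"

definition permute_vars :: "(nat \<Rightarrow> nat) \<Rightarrow> rpoly \<Rightarrow> rpoly" where
  "permute_vars \<sigma> =
     lin_ext (\<lambda>e. \<Prod>k\<in>Poly_Mapping.keys e. var (\<sigma> k) ^ Poly_Mapping.lookup e k)"

text \<open>The subtraction of exponents truncates at 0, but only where the coefficient is 0.\<close>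

definition partial_deriv :: "nat \<Rightarrow> rpoly \<Rightarrow> rpoly" where
  "partial_deriv k =
     lin_ext (\<lambda>e. Poly_Mapping.single (e - Poly_Mapping.single k 1) (real (Poly_Mapping.lookup e k)))"

definition L_op :: "nat \<Rightarrow> (rpoly, rpoly) tensor \<Rightarrow> (rpoly, rpoly) tensor" where
  "L_op n x = (\<Sum>k = 1..n. tensor_map (\<lambda>p. var k * p) (partial_deriv k) x)"

lemma linear_permute_vars: "linear (permute_vars \<sigma>)"
  unfolding permute_vars_def by (rule linear_lin_ext)

lemma permute_vars_var: "permute_vars \<sigma> (var k) = var (\<sigma> k)"
  by (simp add: permute_vars_def var_def)

lemma linear_partial_deriv: "linear (partial_deriv k)"
  unfolding partial_deriv_def by (rule linear_lin_ext)

lemma partial_deriv_var: "partial_deriv k (var j) = (if j = k then 1 else 0)"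
  by (simp add: partial_deriv_def var_def lookup_single)

lemma linear_mult_poly: "linear (\<lambda>p. q * p)" for q :: rpoly
proof (rule linearI)
  have scale: "c *\<^sub>R p = Poly_Mapping.single 0 c * p" for c and p :: rpoly
    by (rule poly_mapping_eqI)
      (simp add: lookup_scaleR_pm mult_map_scale_conv_mult[symmetric] map.rep_eq when_def)
  show "q * (c *\<^sub>R p) = c *\<^sub>R (q * p)" for c and p :: rpoly
    by (simp add: scale mult.left_commute)
qed (rule distrib_left)

lemma L_op_pure: "L_op n (p \<otimes>\<^sub>t q) = (\<Sum>k = 1..n. (var k * p) \<otimes>\<^sub>t partial_deriv k q)"
  unfolding L_op_def by (simp add: tensor_map_pure linear_mult_poly linear_partial_deriv)

end

theory Submission
  imports Defs
begin

text \<open>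
  Regard \<open>\<real>[t] \<otimes> \<real>[t]\<close> as the polynomials in two sets of variables, \<open>t\<close> for the first factor and
  \<open>s\<close> for the second. Then \<open>L\<close> is the polarization operator \<open>E = \<Sum>k. t\<^sub>k \<partial>/\<partial>s\<^sub>k\<close>, and together
  with its mirror image \<open>F = \<Sum>k. s\<^sub>k \<partial>/\<partial>t\<^sub>k\<close> it generates an action of the Lie algebra \<open>sl\<^sub>2\<close>:
  the canonical commutation relations (\<open>partial_deriv_var_mult\<close>) and Euler's identity
  (\<open>euler_identity\<close>) give \<open>E F - F E = a - b\<close> in bidegree \<open>(a, b)\<close>
  (\<open>polarization_commutator\<close>).

  Every step of the chain starts in a bidegree with \<open>a < b\<close>, that is, in negative weight \<open>a - b\<close>,
  and there \<open>E\<close> is injective because \<open>F E\<close> has no eigenvalue \<open>\<mu> \<le> 0\<close>. Indeed, if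
  \<open>F E v = \<mu> v\<close> with \<open>\<mu> \<le> 0\<close>, then \<open>E (F v) = (\<mu> + a - b) v\<close>. Applying \<open>F\<close> once more shows that
  \<open>F v\<close>, of bidegree \<open>(a - 1, b + 1)\<close>, satisfies the same equation with the negative eigenvalue
  \<open>\<mu> + a - b\<close>. By induction on \<open>a\<close>, where \<open>F\<close> vanishes for \<open>a = 0\<close>, it follows that \<open>F v = 0\<close>,
  so \<open>(\<mu> + a - b) v = 0\<close> and \<open>v = 0\<close> (\<open>no_nonpos_eigenvector\<close>). The kernel of \<open>E\<close> is contained
  in the case \<open>\<mu> = 0\<close>.

  Equivariance holds because a permutation \<open>\<sigma>\<close> of the variables carries multiplication by \<open>t\<^sub>k\<close> and
  \<open>\<partial>/\<partial>t\<^sub>k\<close> to the same operators with index \<open>\<sigma> k\<close>, and \<open>L\<close> sums over all indices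
  (\<open>L_op_equivariant\<close>).
\<close>

section \<open>Monomials and the graded pieces\<close>

abbreviation monomial :: "(nat \<Rightarrow>\<^sub>0 nat) \<Rightarrow> rpoly" where
  "monomial e \<equiv> Poly_Mapping.single e 1"

lemma scaleR_monomial: "c *\<^sub>R monomial e = Poly_Mapping.single e c"
  by (rule poly_mapping_eqI) (simp add: lookup_scaleR_pm lookup_single when_def)

lemma rpoly_in_span_monomials: "p \<in> span (monomial ` Poly_Mapping.keys p)"
proof -
  have "lin_ext monomial p \<in> span (monomial ` Poly_Mapping.keys p)"
    unfolding lin_ext_def by (intro span_sum span_scale span_base) auto
  then show ?thesis
    using lin_ext_expansion[of p] by simp
qed

lemma linear_eq_on_monomials:
  assumes "linear f" "linear g" "\<And>e. f (monomial e) = g (monomial e)"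
  shows "f p = g p"
  using lin_ext_unique[of f "\<lambda>e. g (monomial e)" p] lin_ext_unique[of g "\<lambda>e. g (monomial e)" p] assms
  by simp

lemma linear_maps_span:
  assumes "linear h" "subspace U" "\<And>x. x \<in> S \<Longrightarrow> h x \<in> U" "x \<in> span S"
  shows "h x \<in> U"
proof -
  have "span S \<subseteq> h -` U"
    using assms(1-3) by (intro span_minimal linear_subspace_vimage) auto
  then show ?thesis
    using assms(4) by auto
qed

text \<open>Here each variable counts with weight 1, so that this degree is half of the
  cohomological one.\<close>

definition graded_exponents :: "nat \<Rightarrow> nat \<Rightarrow> (nat \<Rightarrow>\<^sub>0 nat) set" where
  "graded_exponents n i = {e. Poly_Mapping.keys e \<subseteq> {1..n} \<and> (\<Sum>k = 1..n. Poly_Mapping.lookup e k) = i}"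

lemma graded_exponents_lookup:
  "e \<in> graded_exponents n i \<Longrightarrow> Poly_Mapping.lookup e k \<noteq> 0 \<Longrightarrow> k \<in> {1..n}"
  unfolding graded_exponents_def using in_keys_iff[of k e] by blast

lemma graded_exponents_alt:
  "e \<in> graded_exponents n i \<longleftrightarrow> Poly_Mapping.keys e \<subseteq> {1..n} \<and> monomial_degree e = 2 * i"
proof (cases "Poly_Mapping.keys e \<subseteq> {1..n}")
  case True
  then have "monomial_degree e = (\<Sum>k = 1..n. 2 * Poly_Mapping.lookup e k)"
    unfolding monomial_degree_def by (intro sum.mono_neutral_left) (auto simp: in_keys_iff)
  then show ?thesis
    using True by (simp add: graded_exponents_def flip: sum_distrib_left)
qed (simp add: graded_exponents_def)

lemma graded_piece_alt: "graded_piece n i = {p. Poly_Mapping.keys p \<subseteq> graded_exponents n i}"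
  by (auto simp: graded_piece_def poly_ring_def graded_exponents_alt subset_iff)

lemma subspace_graded_piece: "subspace (graded_piece n i)"
proof (rule subspaceI)
  show "0 \<in> graded_piece n i"
    by (simp add: graded_piece_alt)
  show "p + q \<in> graded_piece n i" if "p \<in> graded_piece n i" "q \<in> graded_piece n i" for p q
    using that Poly_Mapping.keys_add[of p q] unfolding graded_piece_alt by blast
  show "c *\<^sub>R p \<in> graded_piece n i" if "p \<in> graded_piece n i" for c p
    using that by (auto simp: graded_piece_alt in_keys_iff lookup_scaleR_pm subset_iff)
qed

lemma graded_piece_eq_span: "graded_piece n i = span (monomial ` graded_exponents n i)"
proof
  show "graded_piece n i \<subseteq> span (monomial ` graded_exponents n i)"
  proof
    fix p assume "p \<in> graded_piece n i"
    then have "span (monomial ` Poly_Mapping.keys p) \<subseteq> span (monomial ` graded_exponents n i)"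
      by (intro span_mono image_mono) (simp add: graded_piece_alt)
    then show "p \<in> span (monomial ` graded_exponents n i)"
      using rpoly_in_span_monomials by blast
  qed
  show "span (monomial ` graded_exponents n i) \<subseteq> graded_piece n i"
    by (intro span_minimal subspace_graded_piece) (auto simp: graded_piece_alt)
qed

text \<open>Multiplication by a variable, partial derivatives and permutations of the variables are known on
  monomials; this reduces where they send a graded piece to a computation with exponents.\<close>

lemma linear_maps_graded_piece:
  assumes "linear h" "subspace U" "\<And>e. e \<in> graded_exponents n i \<Longrightarrow> h (monomial e) \<in> U"
    and "p \<in> graded_piece n i"
  shows "h p \<in> U"
  by (rule linear_maps_span[OF assms(1,2) _ assms(4)[unfolded graded_piece_eq_span]])
    (use assms(3) in blast)

lemma monomial_in_graded_piece: "monomial e \<in> graded_piece n i \<longleftrightarrow> e \<in> graded_exponents n i"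
  by (simp add: graded_piece_alt)

section \<open>Multiplication by a variable and partial derivatives\<close>

lemma var_mult_monomial: "var k * monomial e = monomial (Poly_Mapping.single k 1 + e)"
  by (simp add: var_def mult_single)

lemma partial_deriv_monomial:
  "partial_deriv k (monomial e)
    = real (Poly_Mapping.lookup e k) *\<^sub>R monomial (e - Poly_Mapping.single k 1)"
  by (simp add: partial_deriv_def scaleR_monomial)

lemma exponent_minus_plus_single:
  assumes "Poly_Mapping.lookup e k \<noteq> 0"
  shows "Poly_Mapping.single k 1 + (e - Poly_Mapping.single k 1) = (e :: nat \<Rightarrow>\<^sub>0 nat)"
  using assms by (intro poly_mapping_eqI) (auto simp: lookup_add lookup_minus lookup_single when_def)

lemma var_mult_graded_piece:
  assumes "k \<in> {1..n}" "p \<in> graded_piece n i"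
  shows "var k * p \<in> graded_piece n (Suc i)"
proof (rule linear_maps_graded_piece[OF linear_mult_poly subspace_graded_piece _ assms(2)])
  fix e assume e: "e \<in> graded_exponents n i"
  have "(\<Sum>j = 1..n. Poly_Mapping.lookup (Poly_Mapping.single k 1 + e) j) = Suc i"
    using e assms(1) by (simp add: lookup_add sum.distrib graded_exponents_def lookup_single when_def)
  moreover have "Poly_Mapping.keys (Poly_Mapping.single k 1 + e) \<subseteq> {1..n}"
    using e assms(1) Poly_Mapping.keys_add[of "Poly_Mapping.single k (1::nat)" e]
    by (auto simp: graded_exponents_def split: if_splits)
  ultimately show "var k * monomial e \<in> graded_piece n (Suc i)"
    unfolding var_mult_monomial monomial_in_graded_piece by (simp add: graded_exponents_def)
qed

lemma partial_deriv_graded_piece: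
  assumes "p \<in> graded_piece n (Suc i)"
  shows "partial_deriv k p \<in> graded_piece n i"
proof (rule linear_maps_graded_piece[OF linear_partial_deriv subspace_graded_piece _ assms])
  fix e assume e: "e \<in> graded_exponents n (Suc i)"
  show "partial_deriv k (monomial e) \<in> graded_piece n i"
  proof (cases "Poly_Mapping.lookup e k = 0")
    case True
    then show ?thesis
      by (simp add: partial_deriv_monomial subspace_0[OF subspace_graded_piece])
  next
    case False
    let ?e = "e - Poly_Mapping.single k 1"
    have k: "k \<in> {1..n}"
      using e False by (rule graded_exponents_lookup)
    have "(\<Sum>j = 1..n. Poly_Mapping.lookup (Poly_Mapping.single k 1 + ?e) j) = Suc i"
      using e exponent_minus_plus_single[OF False] by (simp add: graded_exponents_def)
    then have "(\<Sum>j = 1..n. Poly_Mapping.lookup ?e j) = i"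
      using k unfolding lookup_add sum.distrib by (simp add: lookup_single when_def)
    moreover have "Poly_Mapping.keys ?e \<subseteq> {1..n}"
    proof
      fix j assume "j \<in> Poly_Mapping.keys ?e"
      then have "Poly_Mapping.lookup e j \<noteq> 0"
        unfolding in_keys_iff lookup_minus by (metis diff_0_eq_0)
      with e show "j \<in> {1..n}"
        by (rule graded_exponents_lookup)
    qed
    ultimately have "?e \<in> graded_exponents n i"
      by (simp add: graded_exponents_def)
    then show ?thesis
      unfolding partial_deriv_monomial
      by (intro subspace_scale[OF subspace_graded_piece]) (simp add: monomial_in_graded_piece)
  qed
qed

lemma partial_deriv_graded_piece_0:
  assumes "p \<in> graded_piece n 0"
  shows "partial_deriv k p = 0"
proof -
  have "partial_deriv k p \<in> {0}"
  proof (rule linear_maps_graded_piece[OF linear_partial_deriv _ _ assms])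
    fix e assume e: "e \<in> graded_exponents n 0"
    then have "(\<Sum>j = 1..n. Poly_Mapping.lookup e j) = 0"
      unfolding graded_exponents_def by blast
    then have "\<forall>j\<in>{1..n}. Poly_Mapping.lookup e j = 0"
      by (simp only: sum_eq_0_iff finite_atLeastAtMost)
    then have "Poly_Mapping.lookup e k = 0"
      using graded_exponents_lookup[OF e] by blast
    then show "partial_deriv k (monomial e) \<in> {0}"
      by (simp add: partial_deriv_monomial)
  qed simp
  then show ?thesis by simp
qed

text \<open>The canonical commutation relation \<open>[\<partial>\<^sub>j, t\<^sub>k] = \<delta>\<^sub>j\<^sub>k\<close>.\<close>

lemma partial_deriv_var_mult:
  "partial_deriv j (var k * p) = var k * partial_deriv j p + (if j = k then p else 0)"
proof (rule linear_eq_on_monomials[where p = p])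
  show "linear (\<lambda>p. partial_deriv j (var k * p))"
    using linear_compose[OF linear_mult_poly linear_partial_deriv] by (simp add: comp_def)
  have "linear (\<lambda>p. if j = k then p else (0::rpoly))"
    by (cases "j = k") (simp_all add: linear_iff)
  then show "linear (\<lambda>p. var k * partial_deriv j p + (if j = k then p else 0))"
    using linear_compose[OF linear_partial_deriv linear_mult_poly]
    by (intro linear_compose_add) (simp_all add: comp_def)
  fix e :: "nat \<Rightarrow>\<^sub>0 nat"
  let ?d = "\<lambda>i. Poly_Mapping.single i (1::nat)"
  have scale: "var k * (c *\<^sub>R monomial e') = c *\<^sub>R monomial (?d k + e')" for c e'
    by (simp add: linear_scale[OF linear_mult_poly] var_mult_monomial del: One_nat_def)
  show "partial_deriv j (var k * monomial e)
      = var k * partial_deriv j (monomial e) + (if j = k then monomial e else 0)"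
  proof (cases "Poly_Mapping.lookup e j = 0")
    case True
    then show ?thesis
      by (simp add: var_mult_monomial partial_deriv_monomial lookup_add lookup_single)
  next
    case False
    \<comment> \<open>Since \<open>t\<^sub>j\<close> divides the monomial, the truncated subtraction of exponents may be exchanged with
      addition.\<close>
    have "?d k + e - ?d j = ?d k + (e - ?d j)"
      using False
      by (intro poly_mapping_eqI) (auto simp: lookup_add lookup_minus lookup_single when_def)
    moreover have "?d j + (e - ?d j) = e"
      using False by (rule exponent_minus_plus_single)
    ultimately show ?thesis
      unfolding var_mult_monomial partial_deriv_monomial scale
      by (auto simp: lookup_add lookup_single scaleR_left_distrib)
  qed
qed

lemma euler_identity:
  assumes "p \<in> graded_piece n i"
  shows "(\<Sum>k = 1..n. var k * partial_deriv k p) = real i *\<^sub>R p"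
proof -
  define D where "D = (\<lambda>p. (\<Sum>k = 1..n. var k * partial_deriv k p) - real i *\<^sub>R p)"
  have "linear (\<lambda>p. var k * partial_deriv k p)" for k
    using linear_compose[OF linear_partial_deriv linear_mult_poly] by (simp add: comp_def)
  then have lin: "linear D"
    unfolding D_def by (intro linear_compose_sub linear_compose_sum ballI linear_scaleR)
  have mono: "D (monomial e) \<in> {0}" if e: "e \<in> graded_exponents n i" for e
  proof -
    have "var k * partial_deriv k (monomial e) = real (Poly_Mapping.lookup e k) *\<^sub>R monomial e" for k
      by (cases "Poly_Mapping.lookup e k = 0")
        (simp_all add: partial_deriv_monomial linear_scale[OF linear_mult_poly] var_mult_monomial
          exponent_minus_plus_single del: One_nat_def)
    then show ?thesis
      using e by (simp add: D_def graded_exponents_def flip: scaleR_left.sum of_nat_sum)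
  qed
  have "D p \<in> {0}"
    by (rule linear_maps_graded_piece[OF lin _ mono assms]) simp_all
  then show ?thesis by (simp add: D_def)
qed

section \<open>Permutation of the variables\<close>

definition permute_exponents :: "(nat \<Rightarrow> nat) \<Rightarrow> (nat \<Rightarrow>\<^sub>0 nat) \<Rightarrow> (nat \<Rightarrow>\<^sub>0 nat)" where
  "permute_exponents \<sigma> e = (\<Sum>k\<in>Poly_Mapping.keys e. Poly_Mapping.single (\<sigma> k) (Poly_Mapping.lookup e k))"

lemma permute_vars_monomial: "permute_vars \<sigma> (monomial e) = monomial (permute_exponents \<sigma> e)"
proof -
  have pow: "var j ^ m = monomial (Poly_Mapping.single j m)" for j m
    by (induction m) (simp_all add: var_def mult_single flip: single_add)
  have "(\<Prod>k\<in>A. monomial (f k)) = monomial (sum f A)" for A and f :: "nat \<Rightarrow> _"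
    by (induction A rule: infinite_finite_induct) (simp_all add: mult_single)
  then show ?thesis
    by (simp add: permute_vars_def permute_exponents_def pow)
qed

lemma lookup_permute_exponents:
  assumes "inj \<sigma>"
  shows "Poly_Mapping.lookup (permute_exponents \<sigma> e) (\<sigma> k) = Poly_Mapping.lookup e k"
proof -
  have "Poly_Mapping.lookup (permute_exponents \<sigma> e) (\<sigma> k)
      = (\<Sum>j\<in>Poly_Mapping.keys e. if j = k then Poly_Mapping.lookup e j else 0)"
    unfolding permute_exponents_def lookup_sum
    by (intro sum.cong) (auto simp: lookup_single when_def injD[OF assms])
  then show ?thesis
    by (simp add: in_keys_iff)
qed

text \<open>As \<open>\<sigma>\<close> is surjective, it suffices to compare exponents at the indices \<open>\<sigma> k\<close>, where
  \<open>permute_exponents\<close> is known without inverting \<open>\<sigma>\<close>.\<close>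

lemma permute_exponents_eqI:
  assumes "bij \<sigma>" "\<And>k. Poly_Mapping.lookup f (\<sigma> k) = Poly_Mapping.lookup e k"
  shows "permute_exponents \<sigma> e = f"
proof (rule poly_mapping_eqI)
  fix j
  obtain k where "j = \<sigma> k"
    using assms(1) by (metis bij_pointE)
  then show "Poly_Mapping.lookup (permute_exponents \<sigma> e) j = Poly_Mapping.lookup f j"
    using assms lookup_permute_exponents[of \<sigma>] by (simp add: bij_is_inj)
qed

lemma permute_vars_id: "permute_vars id p = p"
proof (rule linear_eq_on_monomials[OF linear_permute_vars, where p = p])
  show "permute_vars id (monomial e) = monomial e" for e
    unfolding permute_vars_monomial by (subst permute_exponents_eqI[of id e e]) simp_all
qed (simp add: linear_iff)

lemma permute_vars_comp:
  assumes "bij \<sigma>" "bij \<tau>"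
  shows "permute_vars (\<sigma> \<circ> \<tau>) p = permute_vars \<sigma> (permute_vars \<tau> p)"
proof (rule linear_eq_on_monomials[OF linear_permute_vars, where p = p])
  show "linear (\<lambda>p. permute_vars \<sigma> (permute_vars \<tau> p))"
    using linear_compose[OF linear_permute_vars linear_permute_vars] by (simp add: comp_def)
  fix e
  have "permute_exponents (\<sigma> \<circ> \<tau>) e = permute_exponents \<sigma> (permute_exponents \<tau> e)"
    using assms by (intro permute_exponents_eqI bij_comp)
      (simp_all add: lookup_permute_exponents bij_is_inj)
  then show "permute_vars (\<sigma> \<circ> \<tau>) (monomial e) = permute_vars \<sigma> (permute_vars \<tau> (monomial e))"
    by (simp add: permute_vars_monomial)
qed

lemma permute_vars_graded_piece:
  assumes "\<sigma> permutes {1..n}" "p \<in> graded_piece n i"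
  shows "permute_vars \<sigma> p \<in> graded_piece n i"
proof (rule linear_maps_graded_piece[OF linear_permute_vars subspace_graded_piece _ assms(2)])
  fix e assume e: "e \<in> graded_exponents n i"
  have bij: "bij \<sigma>"
    using assms(1) by (rule permutes_bij)
  have "(\<Sum>j = 1..n. Poly_Mapping.lookup (permute_exponents \<sigma> e) j)
      = (\<Sum>j = 1..n. Poly_Mapping.lookup e j)"
    using sum.permute[OF assms(1), of "Poly_Mapping.lookup (permute_exponents \<sigma> e)"]
    by (simp add: comp_def lookup_permute_exponents bij bij_is_inj)
  moreover have "j \<in> {1..n}" if "j \<in> Poly_Mapping.keys (permute_exponents \<sigma> e)" for j
  proof -
    obtain k where k: "j = \<sigma> k"
      using bij by (metis bij_pointE)
    then have "k \<in> Poly_Mapping.keys e"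
      using that by (simp add: in_keys_iff lookup_permute_exponents bij bij_is_inj)
    then have "k \<in> {1..n}"
      using e by (auto simp: graded_exponents_def)
    then show ?thesis
      using k permutes_in_image[OF assms(1)] by simp
  qed
  ultimately show "permute_vars \<sigma> (monomial e) \<in> graded_piece n i"
    using e unfolding permute_vars_monomial monomial_in_graded_piece
    by (auto simp: graded_exponents_def)
qed

lemma permute_vars_var_mult:
  assumes "bij \<sigma>"
  shows "permute_vars \<sigma> (var k * p) = var (\<sigma> k) * permute_vars \<sigma> p"
proof (rule linear_eq_on_monomials[where p = p])
  show "linear (\<lambda>p. permute_vars \<sigma> (var k * p))" "linear (\<lambda>p. var (\<sigma> k) * permute_vars \<sigma> p)"
    using linear_compose[OF linear_mult_poly linear_permute_vars]
      linear_compose[OF linear_permute_vars linear_mult_poly] by (simp_all add: comp_def)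
  fix e
  have "permute_exponents \<sigma> (Poly_Mapping.single k 1 + e)
      = Poly_Mapping.single (\<sigma> k) 1 + permute_exponents \<sigma> e"
    using assms by (intro permute_exponents_eqI)
      (auto simp: lookup_add lookup_permute_exponents bij_is_inj lookup_single when_def bij_def inj_eq)
  then show "permute_vars \<sigma> (var k * monomial e) = var (\<sigma> k) * permute_vars \<sigma> (monomial e)"
    by (simp add: permute_vars_monomial var_mult_monomial del: One_nat_def)
qed

lemma permute_vars_partial_deriv:
  assumes "bij \<sigma>"
  shows "permute_vars \<sigma> (partial_deriv k p) = partial_deriv (\<sigma> k) (permute_vars \<sigma> p)"
proof (rule linear_eq_on_monomials[where p = p])
  show "linear (\<lambda>p. permute_vars \<sigma> (partial_deriv k p))"
    "linear (\<lambda>p. partial_deriv (\<sigma> k) (permute_vars \<sigma> p))"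
    using linear_compose[OF linear_partial_deriv linear_permute_vars]
      linear_compose[OF linear_permute_vars linear_partial_deriv] by (simp_all add: comp_def)
  fix e
  have "permute_exponents \<sigma> (e - Poly_Mapping.single k 1)
      = permute_exponents \<sigma> e - Poly_Mapping.single (\<sigma> k) 1"
    using assms by (intro permute_exponents_eqI)
      (auto simp: lookup_minus lookup_permute_exponents bij_is_inj lookup_single when_def bij_def inj_eq)
  then show "permute_vars \<sigma> (partial_deriv k (monomial e))
      = partial_deriv (\<sigma> k) (permute_vars \<sigma> (monomial e))"
    using assms
    by (simp add: permute_vars_monomial partial_deriv_monomial linear_scale[OF linear_permute_vars]
        lookup_permute_exponents bij_is_inj del: One_nat_def)
qed

lemma representation_graded_piece: "representation (sym_group n) permute_vars (graded_piece n i)"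
  unfolding representation_def
proof (intro conjI sym_group_is_group)
qed (auto simp: subspace_graded_piece linear_permute_vars sym_group_def permute_vars_id
    permute_vars_comp permutes_bij permute_vars_graded_piece)

section \<open>Tensor products of representations\<close>

lemma subspace_tensor_space: "subspace (tensor_space V W)"
  by (simp add: tensor_space_def)

lemma pure_tensor_mem: "v \<in> V \<Longrightarrow> w \<in> W \<Longrightarrow> v \<otimes>\<^sub>t w \<in> tensor_space V W"
  unfolding tensor_space_def by (auto intro: span_base)

lemma linear_maps_tensor_space:
  assumes "linear h" "subspace U" "\<And>v w. v \<in> V \<Longrightarrow> w \<in> W \<Longrightarrow> h (v \<otimes>\<^sub>t w) \<in> U"
    and "x \<in> tensor_space V W"
  shows "h x \<in> U"
  by (rule linear_maps_span[OF assms(1,2) _ assms(4)[unfolded tensor_space_def]])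
    (use assms(3) in blast)

lemma linear_eq_on_tensor_space:
  assumes "linear h" "linear h'" "\<And>v w. v \<in> V \<Longrightarrow> w \<in> W \<Longrightarrow> h (v \<otimes>\<^sub>t w) = h' (v \<otimes>\<^sub>t w)"
    and "x \<in> tensor_space V W"
  shows "h x = h' x"
proof -
  have "h x - h' x \<in> {0}"
    by (rule linear_maps_tensor_space[OF linear_compose_sub[OF assms(1,2)] _ _ assms(4)])
      (simp_all add: assms(3))
  then show ?thesis by simp
qed

lemma representation_tensor_space:
  assumes V: "representation G \<rho> V" and W: "representation G \<rho>' W"
  shows "representation G (tensor_action \<rho> \<rho>') (tensor_space V W)"
proof -
  have lin: "linear (\<rho> g)" "linear (\<rho>' g)" if "g \<in> carrier G" for g
    using V W that by (simp_all add: representation_def)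
  have inv: "\<rho> g v \<in> V" "\<rho>' g w \<in> W" if "g \<in> carrier G" "v \<in> V" "w \<in> W" for g v w
    using V W that unfolding representation_def by blast+
  interpret group G
    using V by (simp add: representation_def)
  have lin_act: "linear (tensor_action \<rho> \<rho>' g)"
    and act: "tensor_action \<rho> \<rho>' g (v \<otimes>\<^sub>t w) = \<rho> g v \<otimes>\<^sub>t \<rho>' g w" if "g \<in> carrier G" for g v w
    unfolding tensor_action_def using lin[OF that] by (rule tensor_map_pure)+
  have stable: "tensor_action \<rho> \<rho>' g ` tensor_space V W \<subseteq> tensor_space V W" if g: "g \<in> carrier G" for g
  proof (rule image_subsetI)
    fix x assume x: "x \<in> tensor_space V W"
    show "tensor_action \<rho> \<rho>' g x \<in> tensor_space V W"
      by (rule linear_maps_tensor_space[OF lin_act[OF g] subspace_tensor_space _ x])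
        (simp add: act[OF g] inv[OF g] pure_tensor_mem)
  qed
  have one: "tensor_action \<rho> \<rho>' \<one>\<^bsub>G\<^esub> x = x" if x: "x \<in> tensor_space V W" for x
    by (rule linear_eq_on_tensor_space[OF lin_act[OF one_closed] linear_ident _ x])
      (use V W in \<open>simp add: act representation_def\<close>)
  have mult: "tensor_action \<rho> \<rho>' (g \<otimes>\<^bsub>G\<^esub> h) x = tensor_action \<rho> \<rho>' g (tensor_action \<rho> \<rho>' h x)"
    if gh: "g \<in> carrier G" "h \<in> carrier G" and x: "x \<in> tensor_space V W" for g h x
  proof (rule linear_eq_on_tensor_space[OF lin_act[OF m_closed[OF gh]] _ _ x])
    show "linear (\<lambda>x. tensor_action \<rho> \<rho>' g (tensor_action \<rho> \<rho>' h x))"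
      using linear_compose[OF lin_act[OF gh(2)] lin_act[OF gh(1)]] by (simp add: comp_def)
    fix v w assume "v \<in> V" "w \<in> W"
    then have "\<rho> (g \<otimes>\<^bsub>G\<^esub> h) v = \<rho> g (\<rho> h v)" "\<rho>' (g \<otimes>\<^bsub>G\<^esub> h) w = \<rho>' g (\<rho>' h w)"
      using V W gh unfolding representation_def by blast+
    then show "tensor_action \<rho> \<rho>' (g \<otimes>\<^bsub>G\<^esub> h) (v \<otimes>\<^sub>t w)
        = tensor_action \<rho> \<rho>' g (tensor_action \<rho> \<rho>' h (v \<otimes>\<^sub>t w))"
      by (simp add: act gh m_closed)
  qed
  show ?thesis
    unfolding representation_def
    by (intro conjI ballI is_group subspace_tensor_space lin_act stable one mult)
qed

section \<open>The polarization operators\<close>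

text \<open>The mirror image of \<^const>\<open>L_op\<close>, with the two tensor factors exchanged: the lowering operator of
  the \<open>sl\<^sub>2\<close>-action in which \<^const>\<open>L_op\<close> is the raising operator.\<close>

definition F_op :: "nat \<Rightarrow> (rpoly, rpoly) tensor \<Rightarrow> (rpoly, rpoly) tensor" where
  "F_op n x = (\<Sum>k = 1..n. tensor_map (partial_deriv k) (\<lambda>p. var k * p) x)"

lemma linear_L_op: "linear (L_op n)"
  unfolding L_op_def[abs_def]
  by (intro linear_compose_sum ballI tensor_map_pure(1) linear_mult_poly linear_partial_deriv)

lemma linear_F_op: "linear (F_op n)"
  unfolding F_op_def[abs_def]
  by (intro linear_compose_sum ballI tensor_map_pure(1) linear_mult_poly linear_partial_deriv)

lemma F_op_pure: "F_op n (p \<otimes>\<^sub>t q) = (\<Sum>k = 1..n. partial_deriv k p \<otimes>\<^sub>t (var k * q))"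
  unfolding F_op_def by (simp add: tensor_map_pure linear_mult_poly linear_partial_deriv)

abbreviation bigraded_piece :: "nat \<Rightarrow> nat \<Rightarrow> nat \<Rightarrow> (rpoly, rpoly) tensor set" where
  "bigraded_piece n a b \<equiv> tensor_space (graded_piece n a) (graded_piece n b)"

lemma L_op_bigraded_piece:
  assumes "x \<in> bigraded_piece n a (Suc b)"
  shows "L_op n x \<in> bigraded_piece n (Suc a) b"
  by (rule linear_maps_tensor_space[OF linear_L_op subspace_tensor_space _ assms])
    (unfold L_op_pure, intro subspace_sum[OF subspace_tensor_space] pure_tensor_mem
      var_mult_graded_piece partial_deriv_graded_piece)

lemma F_op_bigraded_piece:
  assumes "x \<in> bigraded_piece n (Suc a) b"
  shows "F_op n x \<in> bigraded_piece n a (Suc b)"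
  by (rule linear_maps_tensor_space[OF linear_F_op subspace_tensor_space _ assms])
    (unfold F_op_pure, intro subspace_sum[OF subspace_tensor_space] pure_tensor_mem
      var_mult_graded_piece partial_deriv_graded_piece)

lemma F_op_bigraded_piece_0:
  assumes "x \<in> bigraded_piece n 0 b"
  shows "F_op n x = 0"
  by (rule linear_eq_on_tensor_space[OF linear_F_op linear_zero _ assms])
    (simp add: F_op_pure partial_deriv_graded_piece_0 bilinear_lzero[OF bilinear_pure_tensor])

text \<open>Commuting \<open>\<partial>\<^sub>j\<close> past \<open>t\<^sub>k\<close> in either factor leaves only the terms with \<open>j = k\<close>, so the
  commutator is the Euler operator of the first factor minus that of the second.\<close>

lemma polarization_commutator:
  assumes "x \<in> bigraded_piece n a b"
  shows "L_op n (F_op n x) = F_op n (L_op n x) + (real a - real b) *\<^sub>R x"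
proof (rule linear_eq_on_tensor_space[OF _ _ _ assms])
  show "linear (\<lambda>x. L_op n (F_op n x))"
    using linear_compose[OF linear_F_op linear_L_op] by (simp add: comp_def)
  show "linear (\<lambda>x. F_op n (L_op n x) + (real a - real b) *\<^sub>R x)"
    using linear_compose[OF linear_L_op linear_F_op]
    by (intro linear_compose_add linear_scaleR) (simp add: comp_def)
  fix p q assume p: "p \<in> graded_piece n a" and q: "q \<in> graded_piece n b"
  note pure = bilinear_ladd[OF bilinear_pure_tensor] bilinear_radd[OF bilinear_pure_tensor]
    bilinear_lzero[OF bilinear_pure_tensor] bilinear_rzero[OF bilinear_pure_tensor]
    bilinear_lmul[OF bilinear_pure_tensor] bilinear_rmul[OF bilinear_pure_tensor]
  \<comment> \<open>The part common to both orders of composition; it cancels in the commutator.\<close>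
  let ?mix = "\<Sum>k = 1..n. \<Sum>j = 1..n. (var j * partial_deriv k p) \<otimes>\<^sub>t (var k * partial_deriv j q)"
  have lin: "linear (\<lambda>u. u \<otimes>\<^sub>t v)" "linear (\<lambda>u. v \<otimes>\<^sub>t u)" for v :: rpoly
    using bilinear_pure_tensor unfolding bilinear_def by blast+
  have sum_left: "(\<Sum>k = 1..n. f k \<otimes>\<^sub>t q) = (\<Sum>k = 1..n. f k) \<otimes>\<^sub>t q" for f :: "nat \<Rightarrow> rpoly"
    by (rule linear_sum[OF lin(1), symmetric])
  have sum_right: "(\<Sum>k = 1..n. p \<otimes>\<^sub>t f k) = p \<otimes>\<^sub>t (\<Sum>k = 1..n. f k)" for f :: "nat \<Rightarrow> rpoly"
    by (rule linear_sum[OF lin(2), symmetric])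
  have delta: "u \<otimes>\<^sub>t (if P then v else 0) = (if P then u \<otimes>\<^sub>t v else 0)"
    "(if P then u else 0) \<otimes>\<^sub>t v = (if P then u \<otimes>\<^sub>t v else 0)" for P and u v :: rpoly
    by (simp_all add: pure)
  have "L_op n (F_op n (p \<otimes>\<^sub>t q)) = ?mix + (\<Sum>k = 1..n. (var k * partial_deriv k p) \<otimes>\<^sub>t q)"
    by (simp add: F_op_pure L_op_pure linear_sum[OF linear_L_op] partial_deriv_var_mult pure delta
        sum.distrib)
  also have "\<dots> = ?mix + real a *\<^sub>R (p \<otimes>\<^sub>t q)"
    unfolding sum_left euler_identity[OF p] pure ..
  finally have LF: "L_op n (F_op n (p \<otimes>\<^sub>t q)) = ?mix + real a *\<^sub>R (p \<otimes>\<^sub>t q)" .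
  have "F_op n (L_op n (p \<otimes>\<^sub>t q))
      = (\<Sum>j = 1..n. \<Sum>k = 1..n. (var j * partial_deriv k p) \<otimes>\<^sub>t (var k * partial_deriv j q))
        + (\<Sum>k = 1..n. p \<otimes>\<^sub>t (var k * partial_deriv k q))"
    by (simp add: F_op_pure L_op_pure linear_sum[OF linear_F_op] partial_deriv_var_mult pure delta
        sum.distrib)
  also have "\<dots> = ?mix + real b *\<^sub>R (p \<otimes>\<^sub>t q)"
    unfolding sum_right euler_identity[OF q] pure by (subst sum.swap) simp
  finally show "L_op n (F_op n (p \<otimes>\<^sub>t q))
      = F_op n (L_op n (p \<otimes>\<^sub>t q)) + (real a - real b) *\<^sub>R (p \<otimes>\<^sub>t q)"
    unfolding LF by (simp add: scaleR_left_diff_distrib)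
qed

text \<open>Admitting all eigenvalues \<open>\<mu> \<le> 0\<close> rather than only \<open>\<mu> = 0\<close>, the kernel of \<open>F E\<close>, is what makes
  the induction on \<open>a\<close> work: if \<open>x\<close> has eigenvalue \<open>\<mu>\<close>, the commutator shifts it to
  \<open>\<mu> + a - b < 0\<close> for \<open>F x\<close>.\<close>

lemma no_nonpos_eigenvector:
  assumes "x \<in> bigraded_piece n a b" "a < b" "\<mu> \<le> 0" "F_op n (L_op n x) = \<mu> *\<^sub>R x"
  shows "x = 0"
  using assms
proof (induction a arbitrary: b x \<mu>)
  case (0 b x \<mu>)
  have "(\<mu> - real b) *\<^sub>R x = L_op n (F_op n x)"
    using polarization_commutator[OF "0.prems"(1)] "0.prems"(4) by (simp add: scaleR_left_diff_distrib)
  also have "\<dots> = 0"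
    using F_op_bigraded_piece_0[OF "0.prems"(1)] by (simp add: linear_0[OF linear_L_op])
  finally show ?case
    using "0.prems"(2,3) by auto
next
  case (Suc a b x \<mu>)
  let ?\<nu> = "\<mu> + (real (Suc a) - real b)"
  have LF: "L_op n (F_op n x) = ?\<nu> *\<^sub>R x"
    using polarization_commutator[OF Suc.prems(1)] Suc.prems(4)
    by (simp only: scaleR_left_distrib)
  have neg: "?\<nu> < 0"
    using Suc.prems(2,3) by simp
  have "F_op n x = 0"
  proof (rule Suc.IH)
    show "F_op n x \<in> bigraded_piece n a (Suc b)"
      using Suc.prems(1) by (rule F_op_bigraded_piece)
    show "F_op n (L_op n (F_op n x)) = ?\<nu> *\<^sub>R F_op n x"
      unfolding LF by (rule linear_scale[OF linear_F_op])
  qed (use Suc.prems(2) neg in simp_all)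
  then have "?\<nu> *\<^sub>R x = 0"
    using LF by (simp add: linear_0[OF linear_L_op])
  then show ?case
    using neg by simp
qed

lemma inj_on_L_op:
  assumes "a < b"
  shows "inj_on (L_op n) (bigraded_piece n a b)"
  unfolding linear_injective_on_subspace_0[OF linear_L_op subspace_tensor_space]
  using no_nonpos_eigenvector[of _ n a b 0] assms by (simp add: linear_0[OF linear_F_op])

text \<open>Acting on both factors sends the \<open>k\<close>-th summand of \<open>L\<close> to the \<open>\<sigma> k\<close>-th one, so the sum is
  merely reindexed.\<close>

lemma L_op_equivariant:
  assumes "\<sigma> permutes {1..n}"
  shows "L_op n (tensor_action permute_vars permute_vars \<sigma> x)
    = tensor_action permute_vars permute_vars \<sigma> (L_op n x)"
proof -
  let ?T = "tensor_action permute_vars permute_vars \<sigma>"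
  have T: "linear ?T" "?T (p \<otimes>\<^sub>t q) = permute_vars \<sigma> p \<otimes>\<^sub>t permute_vars \<sigma> q" for p q
    unfolding tensor_action_def by (rule tensor_map_pure[OF linear_permute_vars linear_permute_vars])+
  have bij: "bij \<sigma>"
    using assms by (rule permutes_bij)
  have "L_op n \<circ> ?T = ?T \<circ> L_op n"
  proof (rule tensor_linear_eqI)
    fix p q
    have "L_op n (?T (p \<otimes>\<^sub>t q))
        = (\<Sum>k = 1..n. (var (\<sigma> k) * permute_vars \<sigma> p) \<otimes>\<^sub>t partial_deriv (\<sigma> k) (permute_vars \<sigma> q))"
      unfolding T L_op_pure by (subst sum.permute[OF assms]) (simp add: comp_def)
    also have "\<dots> = ?T (L_op n (p \<otimes>\<^sub>t q))"
      unfolding L_op_pure linear_sum[OF T(1)] T(2)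
      by (simp add: permute_vars_var_mult[OF bij] permute_vars_partial_deriv[OF bij])
    finally show "(L_op n \<circ> ?T) (p \<otimes>\<^sub>t q) = (?T \<circ> L_op n) (p \<otimes>\<^sub>t q)"
      by simp
  qed (intro linear_compose linear_L_op T(1))+
  then show ?thesis
    by (simp add: fun_eq_iff)
qed

lemma L_op_rep_inclusion:
  assumes "a \<le> b"
  shows "rep_inclusion (sym_group n)
    (tensor_action permute_vars permute_vars) (bigraded_piece n a (Suc b))
    (tensor_action permute_vars permute_vars) (bigraded_piece n (Suc a) b) (L_op n)"
  unfolding rep_inclusion_def
proof (intro conjI representation_tensor_space representation_graded_piece linear_L_op)
  show "inj_on (L_op n) (bigraded_piece n a (Suc b))"
    using assms by (intro inj_on_L_op) simp
qed (auto simp: L_op_bigraded_piece sym_group_def L_op_equivariant)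

theorem corollary8:
  fixes n :: nat
  assumes "n \<ge> 1"
  shows "strongly_equiv_log_concave (sym_group n) permute_vars (graded_piece n)
    \<and> (\<forall>m. \<forall>i\<in>{1..m div 2}.
         rep_inclusion (sym_group n)
           (tensor_action permute_vars permute_vars)
           (tensor_space (graded_piece n (i - 1)) (graded_piece n (m - i + 1)))
           (tensor_action permute_vars permute_vars)
           (tensor_space (graded_piece n i) (graded_piece n (m - i)))
           (L_op n))"
proof -
  have "rep_inclusion (sym_group n)
           (tensor_action permute_vars permute_vars) (bigraded_piece n (i - 1) (m - i + 1))
           (tensor_action permute_vars permute_vars) (bigraded_piece n i (m - i)) (L_op n)"
    if "i \<in> {1..m div 2}" for i m
  proof -
    have "i - 1 \<le> m - i" "Suc (i - 1) = i"
      using that by auto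
    then show ?thesis
      using L_op_rep_inclusion[of "i - 1" "m - i" n] by simp
  qed
  then show ?thesis
    unfolding strongly_equiv_log_concave_def using representation_graded_piece by blast
qed

end
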